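(* For all integers $k\ge 2$ and $n\ge 1$, \[ |\mathcal{SS}_k(n)|=\frac{1}{n+1}\binom{2n}{n}k^n-\binom{2n-1}{n+1}k^{n-1}+O_n(k^{n-2}). \] That is, for each $n\ge 1$ there is a constant $K_n>0$ depending only on $n$ such that for all $k\ge 2$ the difference between $|\mathcal{SS}_k(n)|$ and $\frac{1}{n+1}\binom{2n}{n}k^n-\binom{2n-1}{n+1}k^{n-1}$ is at most $K_n k^{n-2}$ in absolute value.
   Context: A word of length $\ell$ over an alphabet of size $k$ is an element of $[k]^\ell$, where $[k]=\{0,1,\dots,k-1\}$. A word $s=s_1s_2\cdots s_{2n}\in[k]^{2n}$ is a shuffle square if there exist disjoint index sets $I=\{i_1<\cdots<i_n\}$ and $J=\{j_1<\cdots<j_n\}$ contained in $\{1,\dots,2n\}$ (so that they partition $\{1,\dots,2n\}$) with $s_{i_r}=s_{j_r}$ for all $1\le r\le n$. $\mathcal{SS}_k(n)$ denotes the set of all shuffle squares in $[k]^{2n}$. Binomial coefficients $\binom{a}{b}$ with $b>a\ge 0$ are $0$. *)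

theory Defs
  imports Complex_Main
begin

definition words :: "nat \<Rightarrow> nat \<Rightarrow> nat list set" where
  "words k l = {s. length s = l \<and> set s \<subseteq> {..<k}}"

text \<open>The strictly increasing functions \<open>i\<close> and \<open>j\<close> enumerate the index sets
  $I$ and $J$. Positions are counted from 0, as usual for lists.\<close>

definition shuffle_square :: "nat \<Rightarrow> 'a list \<Rightarrow> bool" where
  "shuffle_square n s \<longleftrightarrow> length s = 2 * n \<and>
     (\<exists>i j :: nat \<Rightarrow> nat.
        strict_mono_on {..<n} i \<and> strict_mono_on {..<n} j \<and>
        i ` {..<n} \<subseteq> {..<2 * n} \<and> j ` {..<n} \<subseteq> {..<2 * n} \<and>
        i ` {..<n} \<inter> j ` {..<n} = {} \<and>
        (\<forall>r<n. s ! i r = s ! j r))"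

definition SS :: "nat \<Rightarrow> nat \<Rightarrow> nat list set" where
  "SS k n = {s \<in> words k (2 * n). shuffle_square n s}"

end

theory Submission
  imports Defs
begin

text \<open>Matching the \<open>r\<close>-th element of \<open>I\<close> with the \<open>r\<close>-th element of \<open>J\<close> is a nonnesting
  matching, so a shuffle square is a word that some ballot sequence reads with a queue: each step
  either pushes the current letter or pops an equal letter off the front. A ballot sequence reads
  \<open>k ^ n\<close> words, which gives the Catalan main term. A word with at least \<open>n - 1\<close> distinct letters
  is overcounted only if it has exactly two readings, and these differ by exchanging an adjacent
  push and pop. The words with both readings contribute \<open>k ^ (n - 1)\<close> for each such exchange, and the
  exchanges are counted by \<open>(2 * n - 1) choose (n + 1)\<close>. All remaining words have at most \<open>n - 2\<close>
  distinct letters, and there are only \<open>O(k ^ (n - 2))\<close> of them.\<close>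

section \<open>Reading a word with a queue\<close>

text \<open>\<open>matches Q w s\<close>: starting with the queue \<open>Q\<close>, the steps \<open>w\<close> (\<open>True\<close> for a push) read \<open>s\<close>
  and leave the queue empty.\<close>

inductive matches :: "'a list \<Rightarrow> bool list \<Rightarrow> 'a list \<Rightarrow> bool" where
  matches_Nil: "matches [] [] []"
| matches_push: "matches (Q @ [x]) w s \<Longrightarrow> matches Q (True # w) (x # s)"
| matches_pop: "matches Q w s \<Longrightarrow> matches (x # Q) (False # w) (x # s)"

inductive_simps matches_Nil_word [simp]: "matches Q w []"
inductive_simps matches_Nil_steps [simp]: "matches Q [] s"
inductive_simps matches_True [simp]: "matches Q (True # w) s"
inductive_simps matches_False [simp]: "matches Q (False # w) s"
inductive_simps matches_Cons_word: "matches Q w (x # s)"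

lemma matches_length: "matches Q w s \<Longrightarrow> length w = length s"
  by (induction rule: matches.induct) auto

text \<open>Each copy of \<open>a\<close> in the queue needs one pop, and each pushed copy takes two
  places of \<open>s\<close>, its push and its pop. So \<open>p\<close> is the number of pushes of
  \<open>a\<close>.\<close>

lemma matches_count:
  "matches Q w s \<Longrightarrow> \<exists>p. count_list s a = count_list Q a + 2 * p"
proof (induction rule: matches.induct)
  case (matches_push Q x w s)
  then obtain p where "count_list s a = count_list (Q @ [x]) a + 2 * p" by blast
  then show ?case by (intro exI[of _ "if x = a then Suc p else p"]) auto
qed auto

text \<open>Dropping the steps that read deleted letters keeps the first-in first-out order of the
  rest. This serves to reduce a word to two of its letters.\<close>

lemma matches_filter:
  "matches Q w s \<Longrightarrow> \<exists>w'. matches (filter P Q) w' (filter P s)"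
proof (induction rule: matches.induct)
  case (matches_push Q x w s)
  then show ?case
    by (cases "P x") (auto intro: matches.matches_push)
next
  case (matches_pop Q w s x)
  then show ?case
    by (cases "P x") (auto intro: matches.matches_pop)
qed (auto intro: matches.matches_Nil)

text \<open>A queue returns letters in order of entry: first those already in \<open>Q\<close>, then
  the pushed ones.\<close>

lemma matches_subwords:
  "matches Q w s \<Longrightarrow>
    map snd (filter (\<lambda>p. \<not> fst p) (zip w s)) = Q @ map snd (filter fst (zip w s))"
  by (induction rule: matches.induct) auto

section \<open>Shuffle squares and queue readings\<close>

lemma matches_imp_shuffle_square:
  assumes "matches [] w s" and len: "length s = 2 * n"
  shows "shuffle_square n s"
proof -
  \<comment> \<open>The push positions serve as I and the pop positions as J, each listed
    increasingly.\<close>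
  define xs where "xs = filter (\<lambda>t. w ! t) [0..<2 * n]"
  define ys where "ys = filter (\<lambda>t. \<not> w ! t) [0..<2 * n]"
  have lenw: "length w = 2 * n"
    using matches_length[OF assms(1)] len by simp
  have zip: "zip w s = map (\<lambda>t. (w ! t, s ! t)) [0..<2 * n]"
    using len lenw by (intro nth_equalityI) auto
  have eq: "map ((!) s) ys = map ((!) s) xs"
    using matches_subwords[OF assms(1)] unfolding zip xs_def ys_def
    by (simp add: filter_map o_def)
  have "length xs = length ys"
    using arg_cong[OF eq, of length] by simp
  moreover have "length xs + length ys = 2 * n"
    unfolding xs_def ys_def using sum_length_filter_compl[of "\<lambda>t. w ! t" "[0..<2 * n]"] by simp
  ultimately have lens: "length xs = n" "length ys = n" by auto
  have "sorted_wrt (<) xs" "sorted_wrt (<) ys"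
    unfolding xs_def ys_def by (auto intro!: sorted_wrt_filter)
  then have "strict_mono_on {..<n} ((!) xs)" "strict_mono_on {..<n} ((!) ys)"
    using lens by (auto simp: strict_mono_on_def sorted_wrt_iff_nth_less)
  moreover have img: "(!) xs ` {..<n} = set xs" "(!) ys ` {..<n} = set ys"
    using lens by (auto simp: set_conv_nth image_iff)
  moreover have "s ! (xs ! r) = s ! (ys ! r)" if "r < n" for r
    using arg_cong[OF eq, of "\<lambda>l. l ! r"] that lens by simp
  moreover have "set xs \<subseteq> {..<2 * n}" "set ys \<subseteq> {..<2 * n}" "set xs \<inter> set ys = {}"
    by (auto simp: xs_def ys_def)
  ultimately show ?thesis
    unfolding shuffle_square_def using len by (intro conjI exI[of _ "(!) xs"] exI[of _ "(!) ys"]) auto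
qed

text \<open>Invariant before position \<open>t\<close>: \<open>q\<close> pairs have been opened and
  \<open>p\<close> of them closed, so the queue holds the letters of the pairs \<open>p\<close> to
  \<open>q - 1\<close>. The induction is on the number of positions left.\<close>

lemma matches_of_enumerations:
  fixes i j :: "nat \<Rightarrow> nat"
  assumes mono: "strict_mono_on {..<n} i" "strict_mono_on {..<n} j"
    and lt: "\<And>r. r < n \<Longrightarrow> i r < j r"
    and cover: "{..<2 * n} = i ` {..<n} \<union> j ` {..<n}"
    and disj: "i ` {..<n} \<inter> j ` {..<n} = {}"
    and eq: "\<And>r. r < n \<Longrightarrow> s ! i r = s ! j r"
    and len: "length s = 2 * n"
    and t: "t \<le> 2 * n" "p \<le> q" "q \<le> n"
    and ip: "\<And>r. r < n \<Longrightarrow> i r < t \<longleftrightarrow> r < q"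
    and jq: "\<And>r. r < n \<Longrightarrow> j r < t \<longleftrightarrow> r < p"
  shows "matches (map (\<lambda>r. s ! i r) [p..<q])
    (map (\<lambda>t. t \<in> i ` {..<n}) [t..<2 * n]) (drop t s)"
  using t ip jq
proof (induction "2 * n - t" arbitrary: t p q)
  case 0
  then have "t = 2 * n" by simp
  moreover have "p = n"
  proof (rule ccontr)
    assume "p \<noteq> n"
    then have "p < n" using 0 by simp
    then have "j p < t" using cover \<open>t = 2 * n\<close> by auto
    then show False using 0 \<open>p < n\<close> by auto
  qed
  ultimately show ?case using 0 len by (auto intro: matches_Nil)
next
  case (Suc m)
  have t: "t < 2 * n" using Suc by simp
  have drop: "drop t s = s ! t # drop (Suc t) s"
    using t len by (simp add: Cons_nth_drop_Suc)
  have upt: "[t..<2 * n] = t # [Suc t..<2 * n]"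
    using t by (simp add: upt_conv_Cons)
  have i_less: "i a < i b \<longleftrightarrow> a < b" if "a < n" "b < n" for a b
    using mono(1) that by (metis lessThan_iff strict_mono_on_less)
  have j_less: "j a < j b \<longleftrightarrow> a < b" if "a < n" "b < n" for a b
    using mono(2) that by (metis lessThan_iff strict_mono_on_less)
  from t cover have "t \<in> i ` {..<n} \<or> t \<in> j ` {..<n}" by blast
  then show ?case
  proof
    assume "t \<in> i ` {..<n}"
    then obtain r where r: "r < n" "t = i r" by auto
    have "r = q"
    proof -
      have "\<not> r < q" using Suc.prems(4)[OF r(1)] r by simp
      moreover have "\<not> q < r" using Suc.prems(4)[of q] r i_less[of q r] by auto
      ultimately show ?thesis by simp
    qed
    have "matches (map (\<lambda>r. s ! i r) [p..<Suc q])
       (map (\<lambda>t. t \<in> i ` {..<n}) [Suc t..<2 * n]) (drop (Suc t) s)"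
    proof (rule Suc.hyps(1))
      show "m = 2 * n - Suc t" using Suc.hyps(2) by simp
      show "(i a < Suc t) = (a < Suc q)" if "a < n" for a
        using that i_less[of r a] r \<open>r = q\<close> by (metis not_less_eq)
      show "(j a < Suc t) = (a < p)" if "a < n" for a
      proof -
        have "j a \<noteq> t" using disj that r by blast
        then show ?thesis using Suc.prems(5)[OF that] by auto
      qed
    qed (use t Suc.prems r \<open>r = q\<close> in auto)
    then show ?thesis
      unfolding drop upt using r \<open>r = q\<close> Suc.prems(2) by auto
  next
    assume tj: "t \<in> j ` {..<n}"
    then obtain r where r: "r < n" "t = j r" by auto
    have "r = p"
    proof -
      have "\<not> r < p" using Suc.prems(5)[OF r(1)] r by simp
      moreover have "\<not> p < r" using Suc.prems(5)[of p] r j_less[of p r] by auto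
      ultimately show ?thesis by simp
    qed
    \<comment> \<open>The partner \<open>i p\<close> lies before \<open>t = j p\<close>, so the
      queue is nonempty and its front is the letter to pop.\<close>
    have "p < q" using Suc.prems(4)[OF r(1)] lt[OF r(1)] r \<open>r = p\<close> by simp
    have "matches (map (\<lambda>r. s ! i r) [Suc p..<q])
       (map (\<lambda>t. t \<in> i ` {..<n}) [Suc t..<2 * n]) (drop (Suc t) s)"
    proof (rule Suc.hyps(1))
      show "m = 2 * n - Suc t" using Suc.hyps(2) by simp
      show "(j a < Suc t) = (a < Suc p)" if "a < n" for a
        using that j_less[of r a] r \<open>r = p\<close> by (metis not_less_eq)
      show "(i a < Suc t) = (a < q)" if "a < n" for a
      proof -
        have "i a \<noteq> t" using disj that r by blast
        then show ?thesis using Suc.prems(4)[OF that] by auto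
      qed
    qed (use t Suc.prems r \<open>p < q\<close> in auto)
    moreover have "t \<notin> i ` {..<n}" using tj disj by blast
    ultimately show ?thesis
      unfolding drop upt using r \<open>r = p\<close> eq[OF r(1)] upt_conv_Cons[OF \<open>p < q\<close>] by simp
  qed
qed

lemma shuffle_square_imp_matches:
  assumes "shuffle_square n s"
  shows "\<exists>w. matches [] w s"
proof -
  from assms obtain i j :: "nat \<Rightarrow> nat" where len: "length s = 2 * n"
    and mono: "strict_mono_on {..<n} i" "strict_mono_on {..<n} j"
    and sub: "i ` {..<n} \<subseteq> {..<2 * n}" "j ` {..<n} \<subseteq> {..<2 * n}"
    and disj: "i ` {..<n} \<inter> j ` {..<n} = {}"
    and eq: "\<forall>r<n. s ! i r = s ! j r"
    unfolding shuffle_square_def by (elim conjE exE) (rule that)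
  \<comment> \<open>Neither index set need come first in every pair. Sorting each pair keeps both
    enumerations strictly increasing and puts the push before the pop.\<close>
  define a where "a r = min (i r) (j r)" for r
  define b where "b r = max (i r) (j r)" for r
  have i_less: "i x < i y" and j_less: "j x < j y" if "x < y" "y < n" for x y
    using mono[THEN strict_mono_onD, of x y] that by auto
  have neq: "i x \<noteq> j y" if "x < n" "y < n" for x y
    using disj that by blast
  have a_mono: "strict_mono_on {..<n} a"
  proof (rule strict_mono_onI)
    fix x y assume "x \<in> {..<n}" "y \<in> {..<n}" "x < y"
    then show "a x < a y" using i_less[of x y] j_less[of x y] by (auto simp: a_def)
  qed
  have b_mono: "strict_mono_on {..<n} b"
  proof (rule strict_mono_onI)
    fix x y assume "x \<in> {..<n}" "y \<in> {..<n}" "x < y"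
    then show "b x < b y" using i_less[of x y] j_less[of x y] by (auto simp: b_def)
  qed
  have disj': "a ` {..<n} \<inter> b ` {..<n} = {}"
  proof (rule ccontr)
    assume "a ` {..<n} \<inter> b ` {..<n} \<noteq> {}"
    then obtain x y where xy: "x < n" "y < n" "a x = b y" by auto
    have "a x < b x" if "x < n" for x using neq[OF that that] by (auto simp: a_def b_def)
    then have "x \<noteq> y" using xy by force
    then have "x < y \<or> y < x" by auto
    then have "i x \<noteq> i y" "j x \<noteq> j y"
      using i_less[of x y] i_less[of y x] j_less[of x y] j_less[of y x] xy by auto
    then show False using xy neq[of x y] neq[of y x]
      by (auto simp: a_def b_def min_def max_def split: if_splits)
  qed
  have sub': "a ` {..<n} \<union> b ` {..<n} \<subseteq> {..<2 * n}"
    using sub by (auto simp: a_def b_def min_def max_def image_subset_iff)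
  have "card (a ` {..<n} \<union> b ` {..<n}) = 2 * n"
    using disj' a_mono b_mono
    by (subst card_Un_disjoint) (auto simp: card_image strict_mono_on_imp_inj_on)
  then have cover: "{..<2 * n} = a ` {..<n} \<union> b ` {..<n}"
    using sub' by (metis card_lessThan card_subset_eq finite_lessThan)
  have "matches (map (\<lambda>r. s ! a r) [0..<0])
      (map (\<lambda>t. t \<in> a ` {..<n}) [0..<2 * n]) (drop 0 s)"
  proof (rule matches_of_enumerations[OF a_mono b_mono _ cover disj' _ len])
    show "a r < b r" if "r < n" for r
      using neq[OF that that] by (auto simp: a_def b_def)
    show "s ! a r = s ! b r" if "r < n" for r
      using eq that by (auto simp: a_def b_def min_def max_def)
  qed auto
  then show ?thesis by auto
qed

lemma shuffle_square_iff_matches: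
  "shuffle_square n s \<longleftrightarrow> length s = 2 * n \<and> (\<exists>w. matches [] w s)"
  using matches_imp_shuffle_square shuffle_square_imp_matches shuffle_square_def by blast

section \<open>Readings of words with almost the maximal number of letters\<close>

text \<open>By \<open>matches_count\<close> the total of each letter in queue and word is even and
  positive, hence at least 2. The hypothesis bounds the average by 2, so every total equals
  2.\<close>

lemma matches_tight_count:
  assumes m: "matches Q w s" and tight: "length Q + length s \<le> 2 * card (set Q \<union> set s)"
    and a: "a \<in> set Q \<union> set s"
  shows "count_list Q a + count_list s a = 2"
proof -
  let ?A = "set Q \<union> set s"
  let ?c = "\<lambda>b. count_list Q b + count_list s b"
  have ge: "2 \<le> ?c b" if "b \<in> ?A" for b
  proof -
    obtain p where "count_list s b = count_list Q b + 2 * p"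
      using matches_count[OF m] by blast
    moreover have "?c b \<noteq> 0" using that by (auto simp: count_list_0_iff)
    ultimately show ?thesis by auto
  qed
  have "(\<Sum>b\<in>?A. ?c b) = length Q + length s"
    using sum_count_set[of "Q @ s" ?A] by simp
  also have "\<dots> \<le> (\<Sum>b\<in>?A. 2)" using tight by simp
  finally have le: "(\<Sum>b\<in>?A. ?c b) \<le> (\<Sum>b\<in>?A. 2)" .
  show ?thesis
  proof (rule ccontr)
    assume "?c a \<noteq> 2"
    with ge[OF a] have "2 < ?c a" by simp
    then have "(\<Sum>b\<in>?A. 2) < (\<Sum>b\<in>?A. ?c b)"
      using ge a by (intro sum_strict_mono_ex1) auto
    with le show False by simp
  qed
qed

lemma card_letters_Cons_Cons_le:
  "card (set (x # Q) \<union> set (x # s)) \<le> Suc (card (set Q \<union> set s))"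
  by (simp add: card_insert_if)

text \<open>After pushing a second \<open>x\<close>, two pops of \<open>x\<close> would be due, but
  the tight count leaves no \<open>x\<close> in \<open>s\<close>.\<close>

lemma matches_tight_no_push:
  assumes m: "matches (x # Q @ [x]) w s"
    and tight: "length (x # Q) + length (x # s) \<le> 2 * card (set (x # Q) \<union> set (x # s))"
  shows False
proof -
  have "count_list (x # Q) x + count_list (x # s) x = 2"
    by (rule matches_tight_count[OF _ tight]) (use m in \<open>auto intro: matches_push\<close>)
  moreover obtain p where "count_list s x = count_list (x # Q @ [x]) x + 2 * p"
    using matches_count[OF m] by blast
  ultimately show False by simp
qed

text \<open>Every step is forced: a letter equal to the front cannot be pushed, and any other letter
  cannot be popped. Tightness survives, since a pop lowers the total length by two and the number of
  distinct letters by at most one.\<close>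

lemma matches_tight_unique:
  assumes "matches Q w s" "matches Q w' s" "length Q + length s \<le> 2 * card (set Q \<union> set s)"
  shows "w = w'"
  using assms
proof (induction arbitrary: w' rule: matches.induct)
  case (matches_push Q x w s)
  from matches_push.prems(1) show ?case
  proof cases
    case (matches_push v)
    moreover have "w = v"
      using matches_push.IH \<open>matches (Q @ [x]) v s\<close> matches_push.prems(2) by simp
    ultimately show ?thesis by simp
  next
    case (matches_pop Q' v)
    then show ?thesis
      using matches_tight_no_push[of x Q' w s] matches_push.hyps matches_push.prems(2) by simp
  qed
next
  case (matches_pop Q w s x)
  from matches_pop.prems(1) show ?case
  proof cases
    case (matches_push v)
    then show ?thesis
      using matches_tight_no_push[of x Q v s] matches_pop.prems(2) by simp
  next
    case (matches_pop v)
    moreover have "w = v"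
      using matches_pop.IH \<open>matches Q v s\<close> matches_pop.prems(2)
        card_letters_Cons_Cons_le[of x Q s] by simp
    ultimately show ?thesis by simp
  qed
qed simp

lemma filter_two_letters:
  assumes "q \<noteq> r"
  shows "length (filter (\<lambda>x. x = q \<or> x = r) xs) = count_list xs q + count_list xs r"
  using assms by (induction xs) auto

text \<open>This is a branching point: the queue \<open>q # Q\<close> has met the letter
  \<open>q\<close>, and both pushing (\<open>U\<close>) and popping (\<open>D\<close>) can be
  completed. The push branch still has to pop \<open>q\<close> twice, so by tightness
  \<open>s\<close> holds both copies of \<open>q\<close> and \<open>Q\<close> none. Any other next
  letter would block one of the readings.\<close>

lemma push_pop_next_letter:
  assumes U: "matches (q # Q @ [q]) w s" and D: "matches Q v s"
    and tight: "length Q + length s \<le> 2 * card (set Q \<union> set s)"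
  shows "\<exists>s'. s = q # s'"
proof -
  obtain p where "count_list s q = count_list (q # Q @ [q]) q + 2 * p"
    using matches_count[OF U] by blast
  then have ge: "count_list s q \<ge> 2" by simp
  then have "q \<in> set s" using count_list_0_iff[of s q] by force
  then have cq: "count_list Q q = 0" "count_list s q = 2"
    using matches_tight_count[OF D tight, of q] ge by auto
  obtain r s' where s: "s = r # s'" using \<open>q \<in> set s\<close> by (cases s) auto
  have "r = q"
  proof (rule ccontr)
    assume "r \<noteq> q"
    \<comment> \<open>Deleting all letters but \<open>q\<close> and \<open>r\<close> preserves both readings and leaves
      only finitely many words, for each of which one of the readings fails.\<close>
    let ?P = "\<lambda>x. x = q \<or> x = r"
    obtain p where p: "count_list s r = count_list Q r + 2 * p"
      using matches_count[OF D] by blast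
    have cr: "count_list Q r + count_list s r = 2"
      using matches_tight_count[OF D tight, of r] s by simp
    define t where "t = filter ?P s'"
    define R where "R = filter ?P Q"
    have set_t: "set t \<subseteq> {q, r}" and set_R: "set R \<subseteq> {q, r}"
      by (auto simp: t_def R_def)
    have len_t: "length t = 2 + count_list s' r" and len_R: "length R = count_list Q r"
      unfolding t_def R_def using filter_two_letters[of q r] \<open>r \<noteq> q\<close> cq s by auto
    have "filter ?P s = r # t" by (simp add: s t_def)
    moreover have "filter ?P (q # Q @ [q]) = q # R @ [q]" by (simp add: R_def)
    ultimately obtain w' v' where U': "matches (q # R @ [q]) w' (r # t)"
      and D': "matches R v' (r # t)"
      using matches_filter[OF U, of ?P] matches_filter[OF D, of ?P] R_def by auto
    \<comment> \<open>The total of \<open>r\<close> is 2: either one copy is already queued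
      (\<open>p = 0\<close>), or \<open>r\<close> is pushed once and popped once
      (\<open>p = 1\<close>). In both cases the head of \<open>s\<close> uses up one copy.\<close>
    have "count_list Q r = 1 \<and> count_list s' r = 0 \<or> count_list Q r = 0 \<and> count_list s' r = 1"
      using cr p s by (cases p) auto
    then show False
    proof
      assume "count_list Q r = 1 \<and> count_list s' r = 0"
      then have "length t = 2" "length R = 1" using len_t len_R by auto
      then obtain x y z where "t = [x, y]" "R = [z]"
        by (auto simp: length_Suc_conv numeral_2_eq_2)
      moreover have "z \<noteq> q" using cq(1) R_def[symmetric] \<open>R = [z]\<close>
        by (auto simp: count_list_0_iff filter_eq_Cons_iff)
      ultimately show False
        using U' D' set_t set_R \<open>r \<noteq> q\<close> by (auto simp: matches_Cons_word)
    next
      assume "count_list Q r = 0 \<and> count_list s' r = 1"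
      then have "length t = 3" "R = []" using len_t len_R by auto
      then obtain x y z where "t = [x, y, z]"
        by (auto simp: length_Suc_conv numeral_3_eq_3)
      then show False
        using U' D' set_t \<open>r \<noteq> q\<close> \<open>R = []\<close> by (auto simp: matches_Cons_word)
    qed
  qed
  with s show ?thesis by blast
qed

section \<open>Sets of readings that differ by one exchange\<close>

definition swaps :: "bool list set \<Rightarrow> (bool list \<times> bool list) set" where
  "swaps A = {(a, b). a @ True # False # b \<in> A \<and> a @ False # True # b \<in> A}"

text \<open>The prefix \<open>a\<close> is the longest common prefix of the two sequences, so the
  unordered pair determines it, and then \<open>b\<close>.\<close>

lemma swap_position_unique:
  "{a @ True # False # b, a @ False # True # b} = {a' @ True # False # b', a' @ False # True # b'}
    \<Longrightarrow> a = a' \<and> b = b'"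
proof (induction a arbitrary: a')
  case Nil
  then show ?case by (cases a') (auto simp: doubleton_eq_iff)
next
  case (Cons x a)
  then show ?case by (cases a') (auto simp: doubleton_eq_iff)
qed

lemma swaps_doubleton:
  "swaps {a @ True # False # b, a @ False # True # b} = {(a, b)}"
proof -
  have "(a', b') = (a, b)" if "(a', b') \<in> swaps {a @ True # False # b, a @ False # True # b}" for a' b'
  proof -
    have "{a @ True # False # b, a @ False # True # b} = {a' @ True # False # b', a' @ False # True # b'}"
    proof -
      have "a' @ True # False # b' \<noteq> a' @ False # True # b'" by simp
      then show ?thesis using that unfolding swaps_def
        by (simp only: mem_Collect_eq case_prod_conv insert_iff empty_iff doubleton_eq_iff) metis
    qed
    then show ?thesis using swap_position_unique by blast
  qed
  then show ?thesis by (auto simp: swaps_def)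
qed

lemma swaps_singleton [simp]: "swaps {} = {}" "swaps {w} = {}"
  by (auto simp: swaps_def)

lemma matches_Cons_word_set:
  "{w. matches Q w (x # s)} = (#) True ` {w. matches (Q @ [x]) w s} \<union>
     (if Q \<noteq> [] \<and> hd Q = x then (#) False ` {w. matches (tl Q) w s} else {})"
  by (cases Q) (auto simp: matches_Cons_word)

definition at_most_swap :: "bool list set \<Rightarrow> bool" where
  "at_most_swap A \<longleftrightarrow> A = {} \<or> (\<exists>w. A = {w}) \<or>
     (\<exists>a b. A = {a @ True # False # b, a @ False # True # b})"

lemma at_most_swap_image_Cons: "at_most_swap A \<Longrightarrow> at_most_swap ((#) c ` A)"
proof -
  have "\<exists>a' b'. (#) c ` {a @ True # False # b, a @ False # True # b} =
      {a' @ True # False # b', a' @ False # True # b'}" for a b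
    by (rule exI[of _ "c # a"], rule exI[of _ b]) simp
  then show "at_most_swap A \<Longrightarrow> at_most_swap ((#) c ` A)"
    unfolding at_most_swap_def by (elim disjE exE) simp_all
qed

text \<open>The bound allows one pair of places more than tightness. As long as only one of push and
  pop can be completed, the readings inherit their shape from that branch. Where both can, the pop
  branch is tight, the next letter is again \<open>x\<close>, and the branches meet after one more
  step, with a unique continuation.\<close>

lemma at_most_swap_matches:
  "length Q + length s \<le> 2 * card (set Q \<union> set s) + 2 \<Longrightarrow> at_most_swap {w. matches Q w s}"
proof (induction s arbitrary: Q)
  case Nil
  then show ?case by (cases Q) (auto simp: at_most_swap_def)
next
  case (Cons x s)
  have push: "at_most_swap ((#) True ` {w. matches (Q @ [x]) w s})"
    using Cons by (intro at_most_swap_image_Cons) auto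
  show ?case
  proof (cases "Q \<noteq> [] \<and> hd Q = x")
    case False
    then show ?thesis using push by (auto simp: matches_Cons_word_set)
  next
    case True
    then obtain Q' where Q: "Q = x # Q'" by (cases Q) auto
    have le: "length Q' + length s \<le> 2 * card (set Q' \<union> set s) + 2"
      using Cons.prems card_letters_Cons_Cons_le[of x Q' s] by (simp add: Q)
    have pop: "at_most_swap ((#) False ` {w. matches Q' w s})"
      using Cons.IH[OF le] by (rule at_most_swap_image_Cons)
    show ?thesis
    proof (cases "(\<exists>w. matches (Q @ [x]) w s) \<and> (\<exists>v. matches Q' v s)")
      case False
      then show ?thesis using push pop by (auto simp: matches_Cons_word_set Q)
    next
      case True
      then obtain w v where w: "matches (x # Q' @ [x]) w s" and v: "matches Q' v s"
        by (auto simp: Q)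
      have "x \<in> set s"
        using matches_count[OF w, of x] count_list_0_iff[of s x] by force
      \<comment> \<open>Popping \<open>x\<close> loses no distinct letter, as \<open>x\<close>
        recurs in \<open>s\<close>. The two places removed therefore use up the slack.\<close>
      then have "set Q \<union> set (x # s) = set Q' \<union> set s" by (auto simp: Q)
      then have tight: "length Q' + length s \<le> 2 * card (set Q' \<union> set s)"
        using Cons.prems by (simp add: Q)
      from push_pop_next_letter[OF w v tight] obtain s' where s: "s = x # s'" by blast
      have "Q' = [] \<or> hd Q' \<noteq> x"
      proof (rule ccontr)
        assume "\<not> ?thesis"
        then obtain Q'' where "Q' = x # Q''" by (cases Q') auto
        then show False
          using matches_tight_count[OF v tight, of x] matches_count[OF w, of x] s by auto
      qed
      then have popped: "{w. matches Q' w s} = (#) True ` {w. matches (Q' @ [x]) w s'}"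
        by (auto simp: matches_Cons_word_set s)
      \<comment> \<open>A second push of \<open>x\<close> would require three further copies of
        \<open>x\<close> in \<open>s'\<close>, where at most one is left.\<close>
      have "\<not> matches (x # Q' @ [x, x]) u s'" for u
        using matches_tight_count[OF v tight, of x] matches_count[of "x # Q' @ [x, x]" u s' x]
        by (auto simp: s)
      then have pushed: "{w. matches (Q @ [x]) w s} = (#) False ` {w. matches (Q' @ [x]) w s'}"
        by (auto simp: matches_Cons_word_set s Q)
      obtain u where u: "matches (Q' @ [x]) u s'"
        using popped v by auto
      have unique: "u' = u" if "matches (Q' @ [x]) u' s'" for u'
        using matches_tight_unique[OF matches_push[OF that] matches_push[OF u]] tight by (simp add: s)
      have "{w. matches (Q' @ [x]) w s'} = {u}"
        by (intro equalityI subsetI) (use u in \<open>simp_all add: unique\<close>)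
      then have "{w. matches Q w (x # s)} = {[] @ True # False # u, [] @ False # True # u}"
        using popped pushed unfolding matches_Cons_word_set[of Q x s]
        by (simp add: Q insert_commute)
      then show ?thesis unfolding at_most_swap_def by blast
    qed
  qed
qed

text \<open>Readings minus exchanges is 0, 1 and 2 - 1 in the three cases, which is the indicator of
  being readable.\<close>

lemma card_swaps:
  assumes "at_most_swap A"
  shows "card A = of_bool (A \<noteq> {}) + card (swaps A)"
  using assms unfolding at_most_swap_def
  by (elim disjE exE) (simp_all add: swaps_doubleton)

section \<open>Counting words for given steps\<close>

text \<open>Here \<open>h\<close> is the current queue length: a lattice path from height
  \<open>h\<close> down to 0 that never goes below 0.\<close>

fun ballot :: "nat \<Rightarrow> bool list \<Rightarrow> bool" where
  "ballot h [] \<longleftrightarrow> h = 0"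
| "ballot h (True # w) \<longleftrightarrow> ballot (Suc h) w"
| "ballot h (False # w) \<longleftrightarrow> 0 < h \<and> ballot (h - 1) w"

lemma ballot_length: "ballot h w \<Longrightarrow> length w = 2 * count_list w True + h"
  by (induction h w rule: ballot.induct) auto

lemma words_0 [simp]: "words k 0 = {[]}"
  by (auto simp: words_def)

lemma finite_words: "finite (words k l)"
  using finite_lists_length_eq[of "{..<k}" l] by (simp add: words_def conj_commute)

lemma card_words: "card (words k l) = k ^ l"
  using card_lists_length_eq[of "{..<k}" l] by (simp add: words_def conj_commute)

lemma words_Suc: "words k (Suc l) = (\<Union>x<k. (#) x ` words k l)"
  by (auto simp: words_def length_Suc_conv image_iff)

lemma card_words_Suc:
  "card {s \<in> words k (Suc l). P s} = (\<Sum>x<k. card {s \<in> words k l. P (x # s)})"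
proof -
  have "{s \<in> words k (Suc l). P s} = (\<Union>x<k. (#) x ` {s \<in> words k l. P (x # s)})"
    by (auto simp: words_Suc)
  also have "card \<dots> = (\<Sum>x<k. card ((#) x ` {s \<in> words k l. P (x # s)}))"
    by (rule card_UN_disjoint) (auto simp: finite_words)
  also have "\<dots> = (\<Sum>x<k. card {s \<in> words k l. P (x # s)})"
    by (simp add: card_image)
  finally show ?thesis .
qed

text \<open>A push reads a free letter, while the letter of a pop is dictated by the queue. Hence
  one factor \<open>k\<close> for each push.\<close>

lemma card_matches:
  "set Q \<subseteq> {..<k} \<Longrightarrow> card {s \<in> words k (length w). matches Q w s} =
    (if ballot (length Q) w then k ^ count_list w True else 0)"
proof (induction w arbitrary: Q)
  case Nil
  then show ?case by (auto simp: Collect_conv_if)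
next
  case (Cons c w)
  show ?case
  proof (cases c)
    case True
    have "card {s \<in> words k (length w). matches (Q @ [x]) w s} =
        (if ballot (Suc (length Q)) w then k ^ count_list w True else 0)" if "x < k" for x
      using Cons.IH[of "Q @ [x]"] Cons.prems that by simp
    then show ?thesis using True by (simp add: card_words_Suc)
  next
    case False
    show ?thesis
    proof (cases Q)
      case Nil
      then show ?thesis using False by simp
    next
      case (Cons q Q')
      have "(\<Sum>x<k. card {s \<in> words k (length w). x = q \<and> matches Q' w s}) =
          (\<Sum>x<k. if x = q then card {s \<in> words k (length w). matches Q' w s} else 0)"
        by (intro sum.cong) auto
      then show ?thesis
        using False Cons Cons.IH[of Q'] Cons.prems by (simp add: card_words_Suc)
    qed
  qed
qed

text \<open>At the exchange, both readings are possible only if the two letters equal the front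
  \<open>q\<close> of the queue. Both then reach the same queue \<open>Q' @ [q]\<close>, so the
  exchanged push contributes no factor \<open>k\<close>.\<close>

lemma card_matches_swap:
  "set Q \<subseteq> {..<k} \<Longrightarrow>
    card {s \<in> words k (length a + length b + 2).
      matches Q (a @ True # False # b) s \<and> matches Q (a @ False # True # b) s} =
    (if ballot (length Q) (a @ False # True # b)
     then k ^ (count_list a True + count_list b True) else 0)"
proof (induction a arbitrary: Q)
  case Nil
  show ?case
  proof (cases Q)
    case Nil
    then show ?thesis by simp
  next
    case (Cons q Q')
    have "card {s \<in> words k (length b + 2). matches Q (True # False # b) s \<and> matches Q (False # True # b) s} =
       card ((\<lambda>s. q # q # s) ` {s \<in> words k (length b). matches (Q' @ [q]) b s})"
      using Nil.prems Cons by (intro arg_cong[of _ _ card]) (auto simp: words_Suc)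
    also have "\<dots> = card {s \<in> words k (length b). matches (Q' @ [q]) b s}"
      by (intro card_image) (auto simp: inj_on_def)
    finally show ?thesis
      using card_matches[of "Q' @ [q]" k b] Nil.prems Cons by simp
  qed
next
  case (Cons c a)
  show ?case
  proof (cases c)
    case True
    have "card {s \<in> words k (length a + length b + 2).
          matches (Q @ [x]) (a @ True # False # b) s \<and> matches (Q @ [x]) (a @ False # True # b) s} =
        (if ballot (Suc (length Q)) (a @ False # True # b)
         then k ^ (count_list a True + count_list b True) else 0)" if "x < k" for x
      using Cons.IH[of "Q @ [x]"] Cons.prems that by simp
    then show ?thesis using True by (simp add: card_words_Suc)
  next
    case False
    show ?thesis
    proof (cases Q)
      case Nil
      then show ?thesis using False by simp
    next
      case (Cons q Q')
      let ?M = "\<lambda>s. matches Q' (a @ True # False # b) s \<and> matches Q' (a @ False # True # b) s"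
      have "(\<Sum>x<k. card {s \<in> words k (length a + length b + 2). q = x \<and> ?M s}) =
          (\<Sum>x<k. if q = x then card {s \<in> words k (length a + length b + 2). ?M s} else 0)"
        by (intro sum.cong) auto
      moreover have "{s \<in> words k (length a + length b + 2).
            matches Q (c # a @ True # False # b) (x # s) \<and> matches Q (c # a @ False # True # b) (x # s)} =
          {s \<in> words k (length a + length b + 2). q = x \<and> ?M s}" for x
        using False Cons by auto
      ultimately show ?thesis
        using False Cons Cons.IH[of Q'] Cons.prems by (simp add: card_words_Suc)
    qed
  qed
qed

section \<open>Counting ballot sequences\<close>

definition ballots :: "nat \<Rightarrow> nat \<Rightarrow> bool list set" where
  "ballots h l = {w. length w = l \<and> ballot h w}"

text \<open>Only the pop-first version is tested: popping first needs positive height, and then the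
  push-first version is a ballot sequence too. The length \<open>l\<close> excludes the exchanged
  pair.\<close>

definition swap_ballots :: "nat \<Rightarrow> nat \<Rightarrow> (bool list \<times> bool list) set" where
  "swap_ballots h l = {(a, b). length a + length b = l \<and> ballot h (a @ False # True # b)}"

lemma finite_length_eq: "finite {w :: bool list. length w = l}"
  using finite_lists_length_eq[of "UNIV :: bool set" l] by simp

lemma finite_length_add: "finite {(a :: bool list, b :: bool list). length a + length b = l}"
  by (rule finite_subset[of _ "{a. length a \<le> l} \<times> {b. length b \<le> l}"])
     (use finite_lists_length_le[of "UNIV :: bool set" l] in auto)

lemma finite_ballots: "finite (ballots h l)"
  by (rule finite_subset[OF _ finite_length_eq[of l]]) (auto simp: ballots_def)

lemma finite_swap_ballots: "finite (swap_ballots h l)"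
  by (rule finite_subset[OF _ finite_length_add[of l]]) (auto simp: swap_ballots_def)

lemma ballots_0: "ballots h 0 = (if h = 0 then {[]} else {})"
  by (auto simp: ballots_def)

lemma ballots_Suc:
  "ballots h (Suc l) = (#) True ` ballots (Suc h) l \<union>
     (if h = 0 then {} else (#) False ` ballots (h - 1) l)"
proof -
  have "w \<in> ballots h (Suc l) \<longleftrightarrow> w \<in> (#) True ` ballots (Suc h) l \<union>
     (if h = 0 then {} else (#) False ` ballots (h - 1) l)" for w
  proof (cases w)
    case (Cons b v)
    then show ?thesis by (cases b) (auto simp: ballots_def)
  qed (auto simp: ballots_def)
  then show ?thesis by blast
qed

lemma card_ballots_Suc:
  "card (ballots h (Suc l)) =
    card (ballots (Suc h) l) + (if h = 0 then 0 else card (ballots (h - 1) l))"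
proof -
  have "card ((#) True ` ballots (Suc h) l \<union> (#) False ` ballots (h - 1) l) =
    card (ballots (Suc h) l) + card (ballots (h - 1) l)"
    by (subst card_Un_disjoint) (auto simp: finite_ballots card_image)
  then show ?thesis by (simp add: ballots_Suc card_image)
qed

lemma card_ballots_low: "l < h \<Longrightarrow> card (ballots h l) = 0"
proof -
  assume "l < h"
  then have "ballots h l = {}" by (auto simp: ballots_def dest: ballot_length)
  then show ?thesis by simp
qed

text \<open>These are the ballot numbers, a difference of two neighbouring binomials with
  \<open>u\<close> the number of up steps. The subtracted term stands on the left to stay within the
  natural numbers. The proof follows the recurrence on the first step.\<close>

lemma card_ballots:
  "card (ballots h (2 * u + h)) + (if u = 0 then 0 else (2 * u + h) choose (u - 1)) =
    (2 * u + h) choose u"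
proof (induction u arbitrary: h)
  case 0
  show ?case
    by (induction h) (auto simp: ballots_0 card_ballots_Suc card_ballots_low)
next
  case (Suc u)
  note IH = Suc.IH
  show ?case
  proof (induction h)
    case 0
    have "2 * u + 2 choose u = (2 * u + 1 choose u) + (if u = 0 then 0 else (2 * u + 1) choose (u - 1))"
      by (cases u) auto
    moreover have "2 * u + 1 choose Suc u = 2 * u + 1 choose u"
      using binomial_symmetric[of u "2 * u + 1"] by simp
    ultimately show ?case using IH[of 1] by (simp add: card_ballots_Suc)
  next
    case (Suc h)
    define N where "N = 2 * Suc u + h"
    have "card (ballots (Suc (Suc h)) N) + (if u = 0 then 0 else N choose (u - 1)) = N choose u"
    proof -
      have "2 * u + Suc (Suc h) = N" by (simp add: N_def)
      then show ?thesis using IH[of "Suc (Suc h)"] by (simp only:)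
    qed
    moreover have "card (ballots h N) + (N choose u) = N choose Suc u"
      using Suc.IH by (simp add: N_def)
    moreover have "Suc N choose u = (N choose u) + (if u = 0 then 0 else N choose (u - 1))"
      by (cases u) auto
    moreover have "2 * Suc u + Suc h = Suc N" by (simp add: N_def)
    ultimately show ?case by (simp add: card_ballots_Suc del: mult_Suc_right)
  qed
qed

lemma card_swap_ballots_Suc:
  "card (swap_ballots h (Suc l)) = card (swap_ballots (Suc h) l) +
    (if h = 0 then 0 else card (ballots h (Suc l)) + card (swap_ballots (h - 1) l))"
proof -
  \<comment> \<open>\<open>?X\<close> collects the exchanges at the very start: a pop and a push
    return to height \<open>h\<close>. \<open>?Y\<close> and \<open>?Z\<close> split the others by
    the first step.\<close>
  let ?X = "if h = 0 then {} else (\<lambda>b. ([] :: bool list, b)) ` ballots h (Suc l)"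
  let ?Y = "map_prod ((#) True) id ` swap_ballots (Suc h) l"
  let ?Z = "if h = 0 then {} else map_prod ((#) False) id ` swap_ballots (h - 1) l"
  have "(a, b) \<in> swap_ballots h (Suc l) \<longleftrightarrow> (a, b) \<in> ?X \<union> (?Y \<union> ?Z)" for a b
  proof (cases a)
    case Nil
    then show ?thesis by (auto simp: swap_ballots_def ballots_def)
  next
    case (Cons c v)
    then show ?thesis by (cases c) (auto simp: swap_ballots_def image_iff)
  qed
  then have "swap_ballots h (Suc l) = ?X \<union> (?Y \<union> ?Z)"
    by (intro set_eqI) (simp only: split_paired_all)
  also have "card \<dots> = card ?X + card (?Y \<union> ?Z)"
    by (intro card_Un_disjoint) (auto simp: finite_ballots finite_swap_ballots)
  also have "card (?Y \<union> ?Z) = card ?Y + card ?Z"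
    by (intro card_Un_disjoint) (auto simp: finite_swap_ballots)
  also have "card ?X = (if h = 0 then 0 else card (ballots h (Suc l)))"
    by (simp add: card_image inj_on_def)
  also have "card ?Y = card (swap_ballots (Suc h) l)"
    by (intro card_image) (auto simp: inj_on_def)
  also have "card ?Z = (if h = 0 then 0 else card (swap_ballots (h - 1) l))"
    by (auto intro!: card_image simp: inj_on_def)
  finally show ?thesis by simp
qed

text \<open>Removing the swapped pair leaves a ballot sequence with a marked vertex of positive height.
  There are \<open>l + 1\<close> vertices in all, and the second summand counts those of height zero.\<close>

lemma card_swap_ballots:
  "card (swap_ballots h l) + card (ballots (Suc h) (Suc l)) = Suc l * card (ballots h l)"
proof (induction l arbitrary: h)
  case 0
  have "swap_ballots h 0 = {}" by (auto simp: swap_ballots_def)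
  then show ?case by (simp add: card_ballots_Suc ballots_0)
next
  case (Suc l)
  have up: "card (ballots (Suc h) (Suc (Suc l))) =
      card (ballots (Suc (Suc h)) (Suc l)) + card (ballots h (Suc l))"
    by (simp add: card_ballots_Suc[of "Suc h" "Suc l"])
  show ?case
  proof (cases h)
    case 0
    then show ?thesis
      using Suc.IH[of 1] up card_swap_ballots_Suc[of 0 l] card_ballots_Suc[of 0 l] by simp
  next
    case (Suc g)
    have "card (swap_ballots h (Suc l)) =
        card (swap_ballots (Suc h) l) + card (ballots h (Suc l)) + card (swap_ballots g l)"
      using card_swap_ballots_Suc[of h l] Suc by simp
    moreover have "Suc l * card (ballots h (Suc l)) =
        Suc l * card (ballots (Suc h) l) + Suc l * card (ballots g l)"
      using card_ballots_Suc[of h l] Suc by (simp add: algebra_simps)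
    ultimately show ?thesis
      using \<open>\<And>h. card (swap_ballots h l) + _ h = _ h\<close>[of "Suc h"] Suc.IH[of g] up Suc by simp
  qed
qed

lemma catalan: "Suc m * card (ballots 0 (2 * m)) = (2 * m) choose m"
proof (cases m)
  case 0
  then show ?thesis by (simp add: ballots_0)
next
  case (Suc p)
  have "2 * m - p = Suc m" using Suc by simp
  then have "Suc m * ((2 * m) choose p) = m * ((2 * m) choose m)"
    using binomial_absorb_comp[of "2 * m" p] binomial_absorption[of p "2 * m"] Suc by metis
  moreover have "card (ballots 0 (2 * m)) + ((2 * m) choose p) = (2 * m) choose m"
    using card_ballots[of 0 m] Suc by simp
  then have "Suc m * (card (ballots 0 (2 * m)) + ((2 * m) choose p)) = Suc m * ((2 * m) choose m)"
    by (simp only:)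
  ultimately show ?thesis by (simp add: distrib_left)
qed

text \<open>All vertices number \<open>2 * m + 1\<close> times the Catalan number, which is
  \<open>(2 * m + 1) choose m\<close>. Removing those of height zero, a ballot number, leaves
  \<open>(2 * m + 1) choose (m - 1)\<close>, and symmetry gives the stated form.\<close>

lemma card_swap_ballots_0:
  "card (swap_ballots 0 (2 * m)) = (2 * m + 1) choose (m + 2)"
proof -
  have "Suc m * (Suc (2 * m) * card (ballots 0 (2 * m))) = Suc (2 * m) * ((2 * m) choose m)"
    using catalan[of m] by (metis mult.left_commute)
  also have "\<dots> = Suc m * ((2 * m + 1) choose Suc m)"
    using Suc_times_binomial_eq[of "2 * m" m] by (simp add: mult.commute)
  finally have "Suc (2 * m) * card (ballots 0 (2 * m)) = (2 * m + 1) choose Suc m"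
    by (metis mult_cancel1 nat.distinct(1))
  also have "\<dots> = (2 * m + 1) choose m"
    using binomial_symmetric[of m "2 * m + 1"] by simp
  finally have "card (swap_ballots 0 (2 * m)) + card (ballots 1 (2 * m + 1)) = (2 * m + 1) choose m"
    using card_swap_ballots[of 0 "2 * m"] by simp
  moreover have "card (ballots 1 (2 * m + 1)) + (if m = 0 then 0 else (2 * m + 1) choose (m - 1)) =
      (2 * m + 1) choose m"
    using card_ballots[of 1 m] by simp
  ultimately have "card (swap_ballots 0 (2 * m)) = (if m = 0 then 0 else (2 * m + 1) choose (m - 1))"
    by linarith
  also have "\<dots> = (2 * m + 1) choose (m + 2)"
  proof (cases m)
    case (Suc p)
    then have "p \<le> 2 * m + 1" "2 * m + 1 - p = m + 2" by simp_all
    then have "(2 * m + 1) choose p = (2 * m + 1) choose (m + 2)"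
      by (metis binomial_symmetric)
    then show ?thesis using Suc by (simp del: binomial_Suc_Suc)
  qed simp
  finally show ?thesis .
qed

section \<open>Words with few letters\<close>

text \<open>Such a word is determined by a list \<open>f\<close> of \<open>m\<close> letters
  containing all of its own and a word of \<open>l\<close> indices into \<open>f\<close>.\<close>

lemma card_few_letters:
  assumes "k \<ge> 1"
  shows "card {s \<in> words k l. card (set s) \<le> m} \<le> k ^ m * m ^ l"
proof -
  have "{s \<in> words k l. card (set s) \<le> m} \<subseteq> (\<lambda>(f, g). map ((!) f) g) ` (words k m \<times> words m l)"
  proof
    fix s assume "s \<in> {s \<in> words k l. card (set s) \<le> m}"
    then have s: "length s = l" "set s \<subseteq> {..<k}" "card (set s) \<le> m" by (auto simp: words_def)
    \<comment> \<open>The padding letter 0 belongs to the alphabet because \<open>k\<close> is at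
      least 1.\<close>
    define f where "f = sorted_list_of_set (set s) @ replicate (m - card (set s)) 0"
    have f: "f \<in> words k m" "set s \<subseteq> set f"
      using s assms by (auto simp: f_def words_def)
    have "\<exists>i<m. f ! i = x" if "x \<in> set s" for x
    proof -
      have "x \<in> set f" "length f = m" using that f by (auto simp: words_def)
      then show ?thesis by (auto simp: in_set_conv_nth)
    qed
    then obtain p where p: "\<And>x. x \<in> set s \<Longrightarrow> p x < m \<and> f ! p x = x" by metis
    have "map p s \<in> words m l" using p s by (auto simp: words_def)
    moreover have "s = map ((!) f) (map p s)" using p by (simp add: map_idI)
    ultimately show "s \<in> (\<lambda>(f, g). map ((!) f) g) ` (words k m \<times> words m l)"
      using f by force
  qed
  then have "card {s \<in> words k l. card (set s) \<le> m} \<le> card (words k m \<times> words m l)"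
    by (rule surj_card_le[rotated]) (simp add: finite_words)
  then show ?thesis by (simp add: card_cartesian_product card_words)
qed

section \<open>Double counting\<close>

text \<open>Pairs of a word and a reading are counted by the reading; every ballot sequence of
  length \<open>2 * n\<close> has \<open>n\<close> pushes.\<close>

lemma sum_card_matches:
  "(\<Sum>s\<in>words k (2 * n). card {w. matches [] w s}) = card (ballots 0 (2 * n)) * k ^ n"
proof -
  let ?L = "{w :: bool list. length w = 2 * n}"
  have "(\<Sum>s\<in>words k (2 * n). card {w. matches [] w s}) =
      (\<Sum>s\<in>words k (2 * n). card {w \<in> ?L. matches [] w s})"
    by (intro sum.cong arg_cong[of _ _ card]) (auto simp: words_def dest: matches_length)
  also have "\<dots> = (\<Sum>w\<in>?L. card {s \<in> words k (2 * n). matches [] w s})"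
    using sum.swap_restrict[OF finite_words[of k "2 * n"] finite_length_eq[of "2 * n"],
        where g = "\<lambda>_ _. 1 :: nat" and R = "\<lambda>s w. matches [] w s"] by simp
  also have "\<dots> = (\<Sum>w\<in>?L. if ballot 0 w then k ^ n else 0)"
  proof (intro sum.cong refl)
    fix w assume "w \<in> ?L"
    then show "card {s \<in> words k (2 * n). matches [] w s} = (if ballot 0 w then k ^ n else 0)"
      using card_matches[of "[]" k w] ballot_length[of 0 w] by auto
  qed
  also have "\<dots> = (\<Sum>w\<in>ballots 0 (2 * n). k ^ n)"
    by (intro sum.mono_neutral_cong_right) (auto simp: ballots_def finite_length_eq)
  finally show ?thesis by simp
qed

lemma sum_card_swaps:
  assumes "n \<ge> 1"
  shows "(\<Sum>s\<in>words k (2 * n). card (swaps {w. matches [] w s})) =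
    card (swap_ballots 0 (2 * n - 2)) * k ^ (n - 1)"
proof -
  let ?L = "{(a :: bool list, b :: bool list). length a + length b = 2 * n - 2}"
  let ?M = "\<lambda>s (a, b). matches [] (a @ True # False # b) s \<and> matches [] (a @ False # True # b) s"
  have "(\<Sum>s\<in>words k (2 * n). card (swaps {w. matches [] w s})) =
      (\<Sum>s\<in>words k (2 * n). card {x \<in> ?L. ?M s x})"
    by (intro sum.cong arg_cong[of _ _ card]) (auto simp: swaps_def words_def dest: matches_length)
  also have "\<dots> = (\<Sum>x\<in>?L. card {s \<in> words k (2 * n). ?M s x})"
    using sum.swap_restrict[OF finite_words[of k "2 * n"] finite_length_add[of "2 * n - 2"],
        where g = "\<lambda>_ _. 1 :: nat" and R = ?M] by simp
  also have "\<dots> = (\<Sum>(a, b)\<in>?L. if ballot 0 (a @ False # True # b) then k ^ (n - 1) else 0)"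
  proof (intro sum.cong refl)
    fix x assume "x \<in> ?L"
    then obtain a b where x: "x = (a, b)" "length a + length b = 2 * n - 2" by auto
    then have len: "length a + length b + 2 = 2 * n" using assms by simp
    moreover have "count_list a True + count_list b True = n - 1" if "ballot 0 (a @ False # True # b)"
      using ballot_length[OF that] len by simp
    ultimately show "card {s \<in> words k (2 * n). ?M s x} =
        (case x of (a, b) \<Rightarrow> if ballot 0 (a @ False # True # b) then k ^ (n - 1) else 0)"
      using card_matches_swap[of "[]" k a b] x by simp
  qed
  also have "\<dots> = (\<Sum>x\<in>swap_ballots 0 (2 * n - 2). k ^ (n - 1))"
    by (intro sum.mono_neutral_cong_right) (auto simp: swap_ballots_def finite_length_add split: if_splits)
  finally show ?thesis by simp
qed

lemma card_SS: "card (SS k n) = (\<Sum>s\<in>words k (2 * n). of_bool ({w. matches [] w s} \<noteq> {}))"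
proof -
  have "SS k n = {s \<in> words k (2 * n). {w. matches [] w s} \<noteq> {}}"
    by (auto simp: SS_def shuffle_square_iff_matches words_def)
  then show ?thesis by (simp add: finite_words sum.If_cases of_bool_def Int_def)
qed

text \<open>For the empty queue, having at least \<open>n - 1\<close> distinct letters is exactly
  the slack that \<open>at_most_swap_matches\<close> permits.\<close>

lemma card_matches_few_letters:
  assumes "length s = 2 * n" "n \<le> card (set s) + 1"
  shows "card {w. matches [] w s} =
    of_bool ({w. matches [] w s} \<noteq> {}) + card (swaps {w. matches [] w s})"
  by (rule card_swaps[OF at_most_swap_matches]) (use assms in simp)

lemma card_SS_error:
  assumes "n \<ge> 1" "k \<ge> 1"
  shows "\<bar>real (card (SS k n)) - (real (card (ballots 0 (2 * n))) * real k ^ n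
      - real (card (swap_ballots 0 (2 * n - 2))) * real k ^ (n - 1))\<bar>
    \<le> real ((1 + card {w :: bool list. length w = 2 * n}
        + card {(a :: bool list, b :: bool list). length a + length b = 2 * n - 2})
      * (n - 2) ^ (2 * n)) * real k powi (int n - 2)"
    (is "\<bar>?lhs\<bar> \<le> real (?C * _) * _")
proof -
  let ?W = "\<lambda>s. {w. matches [] w s}"
  \<comment> \<open>\<open>e s\<close> is the contribution of \<open>s\<close> to the error. It
    vanishes outside \<open>F\<close> and is bounded there independently of
    \<open>k\<close>.\<close>
  define e :: "nat list \<Rightarrow> real" where
    "e s = of_bool (?W s \<noteq> {}) - real (card (?W s)) + real (card (swaps (?W s)))" for s
  define F where "F = {s \<in> words k (2 * n). card (set s) + 1 < n}"
  have "?lhs = sum e (words k (2 * n))"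
    using arg_cong[OF sum_card_matches[of k n], of real] arg_cong[OF sum_card_swaps[OF assms(1), of k], of real]
      arg_cong[OF card_SS[of k n], of real]
    by (simp add: e_def sum.distrib sum_subtractf)
  also have "\<dots> = sum e F"
  proof (rule sum.mono_neutral_right)
    show "\<forall>s\<in>words k (2 * n) - F. e s = 0"
    proof
      fix s assume "s \<in> words k (2 * n) - F"
      then have "length s = 2 * n" "n \<le> card (set s) + 1" by (auto simp: F_def words_def)
      from card_matches_few_letters[OF this] show "e s = 0" by (simp add: e_def)
    qed
  qed (auto simp: F_def finite_words)
  finally have lhs: "?lhs = sum e F" .
  have "\<bar>e s\<bar> \<le> real ?C" if "s \<in> F" for s
  proof -
    have "length s = 2 * n" using that by (simp add: F_def words_def)
    then have "card (?W s) \<le> card {w :: bool list. length w = 2 * n}"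
      "card (swaps (?W s)) \<le> card {(a :: bool list, b :: bool list). length a + length b = 2 * n - 2}"
      by (auto intro!: card_mono finite_length_eq finite_length_add simp: swaps_def dest: matches_length)
    then show ?thesis by (auto simp: e_def)
  qed
  then have "\<bar>sum e F\<bar> \<le> real ?C * real (card F)"
    using order.trans[OF sum_abs sum_bounded_above[of F "\<lambda>s. \<bar>e s\<bar>" "real ?C"]]
    by (simp add: mult.commute)
  also have "\<dots> \<le> real ?C * (real ((n - 2) ^ (2 * n)) * real k powi (int n - 2))"
  proof (intro mult_left_mono)
    show "real (card F) \<le> real ((n - 2) ^ (2 * n)) * real k powi (int n - 2)"
    \<comment> \<open>For \<open>n = 1\<close> the truncated \<open>n - 2\<close> differs from the
      exponent \<open>int n - 2 = -1\<close>, but then \<open>F\<close> is empty.\<close>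
    proof (cases "n = 1")
      case True
      then show ?thesis by (simp add: F_def)
    next
      case False
      then have "F = {s \<in> words k (2 * n). card (set s) \<le> n - 2}"
        using assms by (auto simp: F_def)
      then have "card F \<le> k ^ (n - 2) * (n - 2) ^ (2 * n)"
        using card_few_letters[OF assms(2)] by simp
      then have "real (card F) \<le> real (k ^ (n - 2) * (n - 2) ^ (2 * n))"
        by (simp only: of_nat_le_iff)
      moreover have "real k powi (int n - 2) = real k ^ (n - 2)"
      proof -
        have "int n - 2 = int (n - 2)" using False assms by simp
        then show ?thesis by (simp only: power_int_of_nat)
      qed
      ultimately show ?thesis by (simp add: mult.commute)
    qed
  qed simp
  finally show ?thesis unfolding lhs by (simp only: of_nat_mult mult.assoc)
qed

theorem theorem1p1:
  fixes n :: nat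
  assumes "n \<ge> 1"
  shows "\<exists>K :: real. K > 0 \<and> (\<forall>k :: nat. k \<ge> 2 \<longrightarrow>
    \<bar>real (card (SS k n))
      - (1 / (real n + 1) * real ((2 * n) choose n) * real k ^ n
         - real ((2 * n - 1) choose (n + 1)) * real k ^ (n - 1))\<bar>
    \<le> K * real k powi (int n - 2))"
proof -
  have "real (Suc n * card (ballots 0 (2 * n))) = real ((2 * n) choose n)"
    by (simp only: catalan)
  then have cat: "real (card (ballots 0 (2 * n))) = 1 / (real n + 1) * real ((2 * n) choose n)"
    by (simp add: field_simps)
  have "2 * n - 2 = 2 * (n - 1)" "2 * (n - 1) + 1 = 2 * n - 1" "n - 1 + 2 = n + 1"
    using assms by simp_all
  then have swp: "card (swap_ballots 0 (2 * n - 2)) = (2 * n - 1) choose (n + 1)"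
    using card_swap_ballots_0[of "n - 1"] by metis
  obtain C :: nat where C: "\<And>k. k \<ge> 1 \<Longrightarrow>
      \<bar>real (card (SS k n)) - (real (card (ballots 0 (2 * n))) * real k ^ n
        - real (card (swap_ballots 0 (2 * n - 2))) * real k ^ (n - 1))\<bar>
      \<le> real C * real k powi (int n - 2)"
    using card_SS_error[OF assms] by blast
  show ?thesis
  \<comment> \<open>The added 1 makes the constant positive even if \<open>C\<close> is 0.\<close>
  proof (intro exI[of _ "real C + 1"] conjI allI impI)
    fix k :: nat assume "k \<ge> 2"
    then have "\<bar>real (card (SS k n)) - (1 / (real n + 1) * real ((2 * n) choose n) * real k ^ n
         - real ((2 * n - 1) choose (n + 1)) * real k ^ (n - 1))\<bar>
      \<le> real C * real k powi (int n - 2)"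
      using C[of k] unfolding cat swp by simp
    also have "\<dots> \<le> (real C + 1) * real k powi (int n - 2)"
      by (intro mult_right_mono) auto
    finally show "\<bar>real (card (SS k n)) - (1 / (real n + 1) * real ((2 * n) choose n) * real k ^ n
         - real ((2 * n - 1) choose (n + 1)) * real k ^ (n - 1))\<bar>
      \<le> (real C + 1) * real k powi (int n - 2)" .
  qed simp
qed

end
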